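(* Let $n\ge 1$ and $m$ be integers, let $c_1,\dots,c_n$ be complex numbers, and let $\Psi:\mathbb{Z}\to\mathbb{C}$ be a given function. Consider the linear partial difference equation $$U_{i+m,j+1}=c_{1}U_{i,j}+c_{2}U_{i+1,j}+\dots+c_{n}U_{i+(n-1),j}\qquad (i\in\mathbb{Z},\ j\in\mathbb{N}\cup\{0\})$$ for an unknown function $U:\mathbb{Z}\times(\mathbb{N}\cup\{0\})\to\mathbb{C}$, $(i,j)\mapsto U_{i,j}$, with the initial condition $U_{i,0}=\Psi(i)$ for all $i\in\mathbb{Z}$. Then its solution is given, for all $i\in\mathbb{Z}$ and $j\in\mathbb{N}\cup\{0\}$, by $$U_{i,j}=\sum_{(s_1,\dots,s_n)\in I}\binom{j}{s_{1},s_{2},\dots,s_{n}}\left(\prod_{r=1}^{n}c_{r}^{s_{r}}\right)\Psi\Big(i+\sum_{r=1}^{n}r s_{r}-(m+1)j\Big),$$ where $I$ is the set of all $n$-tuples of integers $(s_1,\dots,s_n)$ with $0\le s_k\le j$ for every $k$ and $\sum_{k=1}^{n}s_k=j$.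
   Context: $\mathbb{N}=\{1,2,\dots\}$. The symbol $\binom{j}{s_1,\dots,s_n}=\frac{j!}{s_1!\cdots s_n!}$ (for nonnegative integers with $s_1+\dots+s_n=j$) is the multinomial coefficient. The convention $0^0=1$ is used in powers of coefficients. *)

theory Defs
  imports Complex_Main "HOL-Library.FuncSet"
begin

text \<open>
  An \<open>n\<close>-tuple \<open>(a\<^sub>1, \<dots>, a\<^sub>n)\<close> is a function on \<open>nat\<close> of which only the values at \<open>{1..n}\<close>
  matter.
\<close>

definition solves_difference_eq ::
  "nat \<Rightarrow> int \<Rightarrow> (nat \<Rightarrow> complex) \<Rightarrow> (int \<Rightarrow> nat \<Rightarrow> complex) \<Rightarrow> bool" where
  "solves_difference_eq n m c U \<longleftrightarrow>
     (\<forall>i j. U (i + m) (j + 1) = (\<Sum>k = 1..n. c k * U (i + (int k - 1)) j))"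

text \<open>
  The quotient is taken in \<^typ>\<open>complex\<close>. It is the multinomial coefficient when
  \<open>s 1 + \<dots> + s n = j\<close>, the only case in which it is used.
\<close>

definition multinomial :: "nat \<Rightarrow> nat \<Rightarrow> (nat \<Rightarrow> nat) \<Rightarrow> complex" where
  "multinomial n j s = fact j / (\<Prod>k = 1..n. fact (s k))"

text \<open>
  Extensional functions (constantly \<^const>\<open>undefined\<close> outside \<open>{1..n}\<close>) ensure that each tuple
  is represented exactly once, so that a sum over this set counts it once.
\<close>

definition exponent_tuples :: "nat \<Rightarrow> nat \<Rightarrow> (nat \<Rightarrow> nat) set" where
  "exponent_tuples n j = {s \<in> {1..n} \<rightarrow>\<^sub>E {0..j}. (\<Sum>k = 1..n. s k) = j}"

end

theory Submission
  imports Defs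
begin

text \<open>
  Give the tuple \<open>s\<close> of total degree \<open>j\<close> the weight \<open>j! / (s\<^sub>1! \<dots> s\<^sub>n!) \<cdot> c\<^sub>1^s\<^sub>1 \<dots> c\<^sub>n^s\<^sub>n\<close>, so that
  the claimed solution is a weighted sum of shifted values of \<open>\<Psi>\<close>. Splitting
  \<open>1 = \<Sum>\<^sub>k s\<^sub>k / (j + 1)\<close> in degree \<open>j + 1\<close> distributes the weight of \<open>s\<close> over the tuples
  \<open>s - e\<^sub>k\<close> of degree \<open>j\<close> with \<open>s\<^sub>k > 0\<close>, the \<open>k\<close>-th part being \<open>c\<^sub>k\<close> times the weight of \<open>s - e\<^sub>k\<close>: this is
  Pascal's rule for multinomial coefficients. Summed against an arbitrary function of the tuple it
  becomes \<open>weighted_sum_Suc\<close>. Raising the \<open>k\<close>-th exponent by one increases \<open>\<Sum>\<^sub>r r s\<^sub>r\<close> by \<open>k\<close>, and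
  this matches the shift from \<open>i + m\<close> at time \<open>j + 1\<close> to \<open>i + k - 1\<close> at time \<open>j\<close>; hence the
  formula solves the equation (\<open>formula_Suc\<close>). Since \<open>i + m\<close> runs through all integers, the equation
  determines each time level from the preceding one, so the solution is unique.
\<close>

definition weight :: "nat \<Rightarrow> (nat \<Rightarrow> complex) \<Rightarrow> nat \<Rightarrow> (nat \<Rightarrow> nat) \<Rightarrow> complex" where
  "weight n c j s = multinomial n j s * (\<Prod>r = 1..n. c r ^ s r)"

text \<open>The bound \<open>s k \<le> j\<close> on the entries follows from the value of their sum.\<close>

lemma exponent_tuples_iff:
  "s \<in> exponent_tuples n j \<longleftrightarrow> s \<in> extensional {1..n} \<and> (\<Sum>k = 1..n. s k) = j"
proof -
  have "s k \<le> (\<Sum>k = 1..n. s k)" if "k \<in> {1..n}" for k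
    using that by (intro member_le_sum) auto
  then show ?thesis
    by (auto simp: exponent_tuples_def PiE_def Pi_iff)
qed

lemma exponent_tuples_0: "exponent_tuples n 0 = {\<lambda>k\<in>{1..n}. 0}"
  by (auto simp: exponent_tuples_iff extensional_def restrict_def fun_eq_iff)

lemma sum_fun_upd:
  fixes f :: "nat \<Rightarrow> nat \<Rightarrow> 'a::comm_monoid_add"
  assumes "finite A" "k \<in> A"
  shows "(\<Sum>r\<in>A. f r ((s(k := x)) r)) = f k x + (\<Sum>r\<in>A - {k}. f r (s r))"
  by (subst sum.remove[OF assms]) (auto intro!: sum.cong)

lemma prod_fun_upd:
  fixes f :: "nat \<Rightarrow> nat \<Rightarrow> 'a::comm_monoid_mult"
  assumes "finite A" "k \<in> A"
  shows "(\<Prod>r\<in>A. f r ((s(k := x)) r)) = f k x * (\<Prod>r\<in>A - {k}. f r (s r))"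
  by (subst prod.remove[OF assms]) (auto intro!: prod.cong)

text \<open>
  Tuples with \<open>s k = 0\<close> are left out of the range; in \<open>weighted_sum_Suc\<close> they carry the factor
  \<open>s k\<close> and contribute nothing.
\<close>

lemma bij_betw_raise_exponent:
  assumes k: "k \<in> {1..n}"
  shows "bij_betw (\<lambda>t. t(k := Suc (t k))) (exponent_tuples n j)
    {s \<in> exponent_tuples n (Suc j). s k > 0}"
proof (rule bij_betwI[where g = "\<lambda>s. s(k := s k - 1)"])
  have rest: "(\<Sum>r = 1..n. s r) = s k + (\<Sum>r\<in>{1..n} - {k}. s r)" for s :: "nat \<Rightarrow> nat"
    using k by (intro sum.remove) auto
  have upd: "(\<Sum>r = 1..n. (s(k := x)) r) = x + (\<Sum>r\<in>{1..n} - {k}. s r)"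
    for s :: "nat \<Rightarrow> nat" and x
    using sum_fun_upd[of "{1..n}" k "\<lambda>_ y. y" s x] k by simp
  have ext: "s(k := x) \<in> extensional {1..n}" if "s \<in> extensional {1..n}" for s :: "nat \<Rightarrow> nat" and x
    using that k by (auto simp: extensional_def)
  show "(\<lambda>t. t(k := Suc (t k))) \<in> exponent_tuples n j \<rightarrow> {s \<in> exponent_tuples n (Suc j). s k > 0}"
    by (auto simp: exponent_tuples_iff upd ext rest simp del: One_nat_def)
  show "(\<lambda>s. s(k := s k - 1)) \<in> {s \<in> exponent_tuples n (Suc j). s k > 0} \<rightarrow> exponent_tuples n j"
    by (auto simp: exponent_tuples_iff upd ext rest simp del: One_nat_def)
qed auto

text \<open>
  Pascal's rule, one summand at a time: \<open>Suc (t k)\<close> cancels against \<open>fact (Suc (t k))\<close>, and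
  \<open>Suc j\<close> against \<open>fact (Suc j)\<close>.
\<close>

lemma weight_raise_exponent:
  assumes k: "k \<in> {1..n}"
  shows "of_nat (Suc (t k)) * weight n c (Suc j) (t(k := Suc (t k))) =
    of_nat (Suc j) * (c k * weight n c j t)"
proof -
  let ?D = "\<Prod>r\<in>{1..n} - {k}. fact (t r) :: complex"
  let ?P = "\<Prod>r\<in>{1..n} - {k}. c r ^ t r"
  have D: "(\<Prod>r = 1..n. fact (t r)) = fact (t k) * ?D"
    using k by (intro prod.remove) auto
  have P: "(\<Prod>r = 1..n. c r ^ t r) = c k ^ t k * ?P"
    using k by (intro prod.remove) auto
  have D': "(\<Prod>r = 1..n. fact ((t(k := Suc (t k))) r)) = fact (Suc (t k)) * ?D"
    using prod_fun_upd[of "{1..n}" k "\<lambda>_. fact" t "Suc (t k)"] k by simp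
  have P': "(\<Prod>r = 1..n. c r ^ (t(k := Suc (t k))) r) = c k ^ Suc (t k) * ?P"
    using prod_fun_upd[of "{1..n}" k "\<lambda>r x. c r ^ x" t "Suc (t k)"] k by simp
  have "?D \<noteq> 0" by simp
  moreover have "of_nat (Suc (t k)) \<noteq> (0 :: complex)"
    using of_nat_eq_0_iff by blast
  ultimately show ?thesis
    unfolding weight_def multinomial_def D D' P P' fact_Suc
    by (simp add: divide_simps del: of_nat_Suc)
qed

lemma weighted_sum_Suc:
  "(\<Sum>s\<in>exponent_tuples n (Suc j). weight n c (Suc j) s * g s) =
    (\<Sum>k = 1..n. c k * (\<Sum>t\<in>exponent_tuples n j. weight n c j t * g (t(k := Suc (t k)))))"
proof -
  let ?E = "exponent_tuples n"
  let ?w = "\<lambda>s. weight n c (Suc j) s * g s"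
  have fin: "finite (?E (Suc j))"
    unfolding exponent_tuples_def by (rule finite_subset[of _ "{1..n} \<rightarrow>\<^sub>E {0..Suc j}"])
      (auto intro: finite_PiE)
  have step: "(\<Sum>s\<in>?E (Suc j). of_nat (s k) * ?w s) =
    of_nat (Suc j) * (c k * (\<Sum>t\<in>?E j. weight n c j t * g (t(k := Suc (t k)))))"
    if k: "k \<in> {1..n}" for k
  proof -
    have "(\<Sum>s\<in>?E (Suc j). of_nat (s k) * ?w s) =
      (\<Sum>s\<in>{s \<in> ?E (Suc j). s k > 0}. of_nat (s k) * ?w s)"
      by (rule sum.mono_neutral_right) (auto simp: fin)
    also have "\<dots> = (\<Sum>t\<in>?E j. of_nat (Suc (t k)) * ?w (t(k := Suc (t k))))"
      by (subst sum.reindex_bij_betw[OF bij_betw_raise_exponent[OF k], symmetric]) simp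
    also have "\<dots> = (\<Sum>t\<in>?E j. of_nat (Suc j) * (c k * weight n c j t) * g (t(k := Suc (t k))))"
      by (simp only: mult.assoc[symmetric] weight_raise_exponent[OF k])
    finally show ?thesis
      by (simp only: sum_distrib_left mult.assoc)
  qed
  \<comment> \<open>The factor \<open>Suc j\<close> is the total degree, so it splits into the exponents \<open>s k\<close>.\<close>
  have "of_nat (Suc j) * (\<Sum>s\<in>?E (Suc j). ?w s) = (\<Sum>s\<in>?E (Suc j). \<Sum>k = 1..n. of_nat (s k) * ?w s)"
    unfolding sum_distrib_left
  proof (rule sum.cong[OF refl])
    fix s assume "s \<in> ?E (Suc j)"
    then have "(\<Sum>k = 1..n. s k) = Suc j"
      by (simp add: exponent_tuples_iff)
    then show "of_nat (Suc j) * ?w s = (\<Sum>k = 1..n. of_nat (s k) * ?w s)"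
      by (simp only: flip: of_nat_sum sum_distrib_right)
  qed
  also have "\<dots> = (\<Sum>k = 1..n. \<Sum>s\<in>?E (Suc j). of_nat (s k) * ?w s)"
    by (rule sum.swap)
  also have "\<dots> = of_nat (Suc j) *
    (\<Sum>k = 1..n. c k * (\<Sum>t\<in>?E j. weight n c j t * g (t(k := Suc (t k)))))"
    by (simp only: step sum_distrib_left[of "of_nat (Suc j)"] cong: sum.cong)
  finally show ?thesis
    by (simp del: of_nat_Suc)
qed

definition formula :: "nat \<Rightarrow> int \<Rightarrow> (nat \<Rightarrow> complex) \<Rightarrow> (int \<Rightarrow> complex) \<Rightarrow> int \<Rightarrow> nat \<Rightarrow> complex" where
  "formula n m c \<Psi> i j = (\<Sum>s\<in>exponent_tuples n j.
     weight n c j s * \<Psi> (i + (\<Sum>r = 1..n. int r * int (s r)) - (m + 1) * int j))"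

lemma formula_0: "formula n m c \<Psi> i 0 = \<Psi> i"
  by (simp add: formula_def exponent_tuples_0 weight_def multinomial_def)

lemma formula_Suc:
  "formula n m c \<Psi> (i + m) (Suc j) = (\<Sum>k = 1..n. c k * formula n m c \<Psi> (i + (int k - 1)) j)"
proof -
  have moment: "(\<Sum>r = 1..n. int r * int ((t(k := Suc (t k))) r)) =
    (\<Sum>r = 1..n. int r * int (t r)) + int k" if k: "k \<in> {1..n}" for t :: "nat \<Rightarrow> nat" and k
    using sum_fun_upd[of "{1..n}" k "\<lambda>r x. int r * int x" t "Suc (t k)"] k
      sum.remove[of "{1..n}" k "\<lambda>r. int r * int (t r)"] by (simp add: algebra_simps)
  have index: "i + m + (\<Sum>r = 1..n. int r * int ((t(k := Suc (t k))) r)) - (m + 1) * int (Suc j) =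
    i + (int k - 1) + (\<Sum>r = 1..n. int r * int (t r)) - (m + 1) * int j"
    if k: "k \<in> {1..n}" for t :: "nat \<Rightarrow> nat" and k
    unfolding moment[OF k] by (simp add: algebra_simps)
  show ?thesis
    unfolding formula_def weighted_sum_Suc by (intro sum.cong refl) (simp only: index)
qed

lemma difference_eq_unique:
  assumes U: "solves_difference_eq n m c U" and V: "solves_difference_eq n m c V"
    and init: "\<And>i. U i 0 = V i 0"
  shows "U i j = V i j"
proof (induction j arbitrary: i)
  case 0
  show ?case by (rule init)
next
  case (Suc j)
  have eq: "W i (Suc j) = (\<Sum>k = 1..n. c k * W (i - m + (int k - 1)) j)"
    if "solves_difference_eq n m c W" for W
    using that[unfolded solves_difference_eq_def, rule_format, of "i - m" j] by simp
  show ?case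
    unfolding eq[OF U] eq[OF V] Suc.IH ..
qed

theorem theorem2p2:
  fixes n :: nat and m :: int and c :: "nat \<Rightarrow> complex"
    and \<Psi> :: "int \<Rightarrow> complex" and U :: "int \<Rightarrow> nat \<Rightarrow> complex"
  assumes "n \<ge> 1"
  shows "(solves_difference_eq n m c U \<and> (\<forall>i. U i 0 = \<Psi> i)) \<longleftrightarrow>
    (\<forall>i j. U i j =
      (\<Sum>s \<in> exponent_tuples n j.
         multinomial n j s * (\<Prod>r = 1..n. c r ^ s r) *
         \<Psi> (i + (\<Sum>r = 1..n. int r * int (s r)) - (m + 1) * int j)))"
proof -
  have solution: "solves_difference_eq n m c (formula n m c \<Psi>)"
    by (simp add: solves_difference_eq_def formula_Suc)
  have "(solves_difference_eq n m c U \<and> (\<forall>i. U i 0 = \<Psi> i)) \<longleftrightarrow> (\<forall>i j. U i j = formula n m c \<Psi> i j)"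
    (is "?L \<longleftrightarrow> ?R")
  proof
    assume ?L
    then show ?R
      using difference_eq_unique[OF _ solution] by (simp add: formula_0)
  next
    assume ?R
    then have "U = formula n m c \<Psi>" by (intro ext) simp
    then show ?L
      using solution by (simp add: formula_0)
  qed
  then show ?thesis
    unfolding formula_def weight_def .
qed

end
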